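(* For all integers $n\geq 2$, $$\sum_{\lambda\vdash n}(-1)^{v(\lambda)}I_\lambda^2=0.$$
   Context: A shape $\lambda$ is the Ferrers diagram of an integer partition; $\lambda\vdash n$ means it has $n$ squares. A standard Young tableau (SYT) on an $n$-shape is a filling with $1,\ldots,n$, each once, increasing along rows and down columns. The sign $\mathrm{sgn}(T)$ of a tableau is the sign of the word obtained by reading its entries row by row, left to right, top to bottom; the sign of a word of distinct integers is $(-1)^{\#\text{inversions}}$. $I_\lambda=\sum_{T\in\mathrm{SYT}(\lambda)}\mathrm{sgn}(T)$. $v(\lambda)$ is the maximal number of disjoint vertical dominoes ($2\times1$ rectangles) that fit in $\lambda$. *)

theory Defs
  imports Main "HOL-Library.Disjoint_Sets"
begin

definition partitions_of :: "nat \<Rightarrow> nat list set" where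
  "partitions_of n =
     {\<mu>. sorted_wrt (\<ge>) \<mu> \<and> 0 \<notin> set \<mu> \<and> sum_list \<mu> = n}"

text \<open>Squares are pairs (row, column), counted from 0, rows numbered from top to bottom.\<close>

definition ferrers :: "nat list \<Rightarrow> (nat \<times> nat) set" where
  "ferrers \<mu> = {(i, j). i < length \<mu> \<and> j < \<mu> ! i}"

text \<open>A tableau is represented by the list of its rows, so that its reading word is \<open>concat T\<close>.\<close>

definition SYT :: "nat list \<Rightarrow> nat list list set" where
  "SYT \<mu> =
     {T. map length T = \<mu> \<and>
         distinct (concat T) \<and> set (concat T) = {1..sum_list \<mu>} \<and>
         (\<forall>i j. (i, j) \<in> ferrers \<mu> \<and> (i, Suc j) \<in> ferrers \<mu> \<longrightarrow> T ! i ! j < T ! i ! Suc j) \<and>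
         (\<forall>i j. (i, j) \<in> ferrers \<mu> \<and> (Suc i, j) \<in> ferrers \<mu> \<longrightarrow> T ! i ! j < T ! Suc i ! j)}"

definition inversions :: "nat list \<Rightarrow> (nat \<times> nat) set" where
  "inversions w = {(i, j). i < j \<and> j < length w \<and> w ! i > w ! j}"

definition word_sign :: "nat list \<Rightarrow> int" where
  "word_sign w = (- 1) ^ card (inversions w)"

definition tableau_sign :: "nat list list \<Rightarrow> int" where
  "tableau_sign T = word_sign (concat T)"

definition sign_imbalance :: "nat list \<Rightarrow> int" where
  "sign_imbalance \<mu> = (\<Sum>T\<in>SYT \<mu>. tableau_sign T)"

definition vertical_domino :: "nat \<times> nat \<Rightarrow> (nat \<times> nat) set" where
  "vertical_domino = (\<lambda>(i, j). {(i, j), (Suc i, j)})"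

definition vdomino_packings :: "nat list \<Rightarrow> (nat \<times> nat) set set set" where
  "vdomino_packings \<mu> =
     {D. D \<subseteq> range vertical_domino \<and> disjoint D \<and> \<Union>D \<subseteq> ferrers \<mu>}"

definition vdomino_number :: "nat list \<Rightarrow> nat" where
  "vdomino_number \<mu> = Max (card ` vdomino_packings \<mu>)"

text \<open>The sets over which sums and maxima are taken are finite, so neither
  \<^const>\<open>sum\<close> nor \<^const>\<open>Max\<close> takes a default value.\<close>

lemma finite_partitions_of: "finite (partitions_of n)"
proof (rule finite_subset)
  show "partitions_of n \<subseteq> {xs. set xs \<subseteq> {..n} \<and> length xs \<le> n}"
  proof
    fix xs assume xs: "xs \<in> partitions_of n"
    have "length ys \<le> sum_list ys" if "0 \<notin> set ys" for ys :: "nat list"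
      using that by (induction ys) auto
    then show "xs \<in> {xs. set xs \<subseteq> {..n} \<and> length xs \<le> n}"
      using xs by (auto simp: partitions_of_def member_le_sum_list)
  qed
qed (simp add: finite_lists_length_le)

lemma finite_SYT: "finite (SYT \<mu>)"
proof (rule finite_subset)
  let ?R = "{r. set r \<subseteq> {1..sum_list \<mu>} \<and> length r \<le> sum_list \<mu>}"
  show "SYT \<mu> \<subseteq> {T. set T \<subseteq> ?R \<and> length T = length \<mu>}"
  proof
    fix T assume "T \<in> SYT \<mu>"
    then have len: "map length T = \<mu>" and ent: "set (concat T) = {1..sum_list \<mu>}"
      by (simp_all add: SYT_def)
    have "r \<in> ?R" if "r \<in> set T" for r
    proof -
      have "length r \<in> set \<mu>" using that len by auto
      then have "length r \<le> sum_list \<mu>" by (simp add: member_le_sum_list)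
      moreover have "set r \<subseteq> {1..sum_list \<mu>}" using that ent by auto
      ultimately show ?thesis by simp
    qed
    moreover have "length T = length \<mu>" using len by auto
    ultimately show "T \<in> {T. set T \<subseteq> ?R \<and> length T = length \<mu>}" by blast
  qed
qed (simp add: finite_lists_length_eq finite_lists_length_le)

lemma finite_inversions: "finite (inversions w)"
  by (rule finite_subset[of _ "{..<length w} \<times> {..<length w}"]) (auto simp: inversions_def)

lemma finite_ferrers: "finite (ferrers \<mu>)"
proof -
  have "ferrers \<mu> = Sigma {..<length \<mu>} (\<lambda>i. {..<\<mu> ! i})"
    by (auto simp: ferrers_def)
  then show ?thesis by simp
qed

lemma vdomino_packings_finite_nonempty:
  "finite (vdomino_packings \<mu>)" "vdomino_packings \<mu> \<noteq> {}"
proof -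
  have "vdomino_packings \<mu> \<subseteq> Pow (Pow (ferrers \<mu>))"
    by (auto simp: vdomino_packings_def)
  then show "finite (vdomino_packings \<mu>)"
    by (rule finite_subset) (simp add: finite_ferrers)
  have "{} \<in> vdomino_packings \<mu>"
    by (simp add: vdomino_packings_def disjoint_def)
  then show "vdomino_packings \<mu> \<noteq> {}" by blast
qed

end

theory Submission
  imports Defs "HOL-Library.Multiset"
begin

text \<open>
  Removing the largest entry of a standard tableau gives \<open>I = U\<^sup>n \<emptyset>\<close>, where \<open>U\<close> adds a square to a
  shape in all possible ways, with sign \<open>(-1)\<close> to the number of squares in lower rows. Since \<open>v(\<lambda>)\<close> is
  the number of squares in every second row, the adjoint \<open>D\<close> of \<open>U\<close> for the form
  \<open>\<langle>\<lambda>, \<lambda>\<rangle> = (-1)\<^bsup>v(\<lambda>)\<^esup>\<close> removes squares with the same sign times the parity of the row. Adding and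
  removing in different rows anticommute, the other contributions telescope along the outer and inner
  corners, and so \<open>D U + U D = 1\<close>. Hence \<open>D U\<^sup>2 = U\<^sup>2 D\<close>, and \<open>\<langle>U\<^sup>n \<emptyset>, U\<^sup>n \<emptyset>\<rangle>\<close> vanishes for \<open>n \<ge> 2\<close>.
\<close>

section \<open>Squares added to and removed from shapes, with their signs\<close>

text \<open>Shapes are represented by their row lengths, padded with zeros to a function on the naturals.\<close>

definition cells :: "(nat \<Rightarrow> nat) \<Rightarrow> (nat \<times> nat) set" where
  "cells f = {(i, j). j < f i}"

definition shapes :: "nat \<Rightarrow> (nat \<Rightarrow> nat) set" where
  "shapes n = {f. antimono f \<and> finite (cells f) \<and> card (cells f) = n}"

definition add_box :: "nat \<Rightarrow> (nat \<Rightarrow> nat) \<Rightarrow> nat \<Rightarrow> nat" where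
  "add_box r f = f(r := Suc (f r))"

definition remove_box :: "nat \<Rightarrow> (nat \<Rightarrow> nat) \<Rightarrow> nat \<Rightarrow> nat" where
  "remove_box r f = f(r := f r - 1)"

text \<open>Row 0 has no row above it. It is listed separately because \<open>r - 1\<close>
  truncates to 0 there and the inequality would be false.\<close>

definition addable :: "(nat \<Rightarrow> nat) \<Rightarrow> nat \<Rightarrow> bool" where
  "addable f r \<longleftrightarrow> r = 0 \<or> f r < f (r - 1)"

definition removable :: "(nat \<Rightarrow> nat) \<Rightarrow> nat \<Rightarrow> bool" where
  "removable f r \<longleftrightarrow> f (Suc r) < f r"

text \<open>In the reading word, a largest entry at the end of row \<open>r\<close> forms inversions
  exactly with the entries of the lower rows. Row \<open>r\<close> itself is left out, so the sign
  is the same with or without that entry.\<close>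

definition row_sign :: "(nat \<Rightarrow> nat) \<Rightarrow> nat \<Rightarrow> int" where
  "row_sign f r = (- 1) ^ card {c \<in> cells f. r < fst c}"

text \<open>This is the weight \<open>(-1)^v\<close> of the theorem, by
  \<open>vdomino_number_eq\<close>.\<close>

definition odd_row_sign :: "(nat \<Rightarrow> nat) \<Rightarrow> int" where
  "odd_row_sign f = (- 1) ^ card {c \<in> cells f. odd (fst c)}"

text \<open>A function on shapes is a vector of coefficients. The coefficient of \<open>f\<close> in
  \<open>U x\<close> collects the shapes from which \<open>f\<close> arises by adding a square, so
  the sum for the raising operator runs over removable rows.\<close>

definition signed_up :: "((nat \<Rightarrow> nat) \<Rightarrow> int) \<Rightarrow> (nat \<Rightarrow> nat) \<Rightarrow> int" where
  "signed_up x f = (\<Sum>r | removable f r. row_sign f r * x (remove_box r f))"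

text \<open>The factor \<open>(-1)^r\<close> is the ratio of the weights \<open>odd_row_sign\<close>
  of the two shapes. It makes this operator the adjoint of \<open>signed_up\<close>.\<close>

definition signed_down :: "((nat \<Rightarrow> nat) \<Rightarrow> int) \<Rightarrow> (nat \<Rightarrow> nat) \<Rightarrow> int" where
  "signed_down x f = (\<Sum>r | addable f r. (- 1) ^ r * row_sign f r * x (add_box r f))"

text \<open>The values of \<open>imbalance n\<close> are meant for shapes of size \<open>n\<close>.
  The constant 1 thus stands for the empty shape with coefficient 1.\<close>

primrec imbalance :: "nat \<Rightarrow> (nat \<Rightarrow> nat) \<Rightarrow> int" where
  "imbalance 0 = (\<lambda>_. 1)"
| "imbalance (Suc n) = signed_up (imbalance n)"

lemma remove_add_box [simp]: "remove_box r (add_box r f) = f"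
  by (simp add: remove_box_def add_box_def)

lemma add_remove_box: "removable f r \<Longrightarrow> add_box r (remove_box r f) = f"
  by (auto simp: remove_box_def add_box_def removable_def)

lemma remove_box_add_box_commute:
  "r \<noteq> s \<Longrightarrow> remove_box s (add_box r f) = add_box r (remove_box s f)"
  by (auto simp: remove_box_def add_box_def)

lemma cells_add_box: "cells (add_box r f) = insert (r, f r) (cells f)"
  by (auto simp: cells_def add_box_def split: if_splits)

lemma box_notin_cells [simp]: "(r, f r) \<notin> cells f"
  by (simp add: cells_def)

lemma antimono_add_box:
  assumes "antimono f" "addable f r"
  shows "antimono (add_box r f)"
  unfolding antimono_iff_le_Suc
proof
  fix n
  have "f (Suc n) \<le> f n" using assms(1) by (simp add: antimono_iff_le_Suc)
  then show "add_box r f (Suc n) \<le> add_box r f n"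
    using assms(2) by (auto simp: add_box_def addable_def)
qed

lemma antimono_remove_box:
  assumes "antimono f" "removable f r"
  shows "antimono (remove_box r f)"
  unfolding antimono_iff_le_Suc
proof
  fix n
  have "f (Suc n) \<le> f n" using assms(1) by (simp add: antimono_iff_le_Suc)
  then show "remove_box r f (Suc n) \<le> remove_box r f n"
    using assms(2) by (auto simp: remove_box_def removable_def)
qed

lemma addable_remove_box:
  assumes "antimono f" "removable f r"
  shows "addable (remove_box r f) r"
proof (cases r)
  case (Suc k)
  then have "f r \<le> f k" using assms(1) by (simp add: antimono_iff_le_Suc)
  then show ?thesis using Suc assms(2) by (auto simp: addable_def remove_box_def removable_def)
qed (simp add: addable_def)

lemma removable_add_box:
  assumes "antimono f"
  shows "removable (add_box r f) r"
proof -
  have "f (Suc r) \<le> f r" using assms by (simp add: antimono_iff_le_Suc)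
  then show ?thesis by (simp add: removable_def add_box_def)
qed

lemma removable_pos: "removable f r \<Longrightarrow> 0 < f r"
  by (auto simp: removable_def)

lemma finite_removable:
  assumes "finite (cells f)"
  shows "finite {r. removable f r}"
proof (rule finite_subset)
  show "{r. removable f r} \<subseteq> fst ` cells f"
    by (auto simp: cells_def image_iff dest!: removable_pos)
qed (simp add: assms)

text \<open>A strict descent between rows \<open>r\<close> and \<open>r + 1\<close> makes the upper
  row removable and the lower one addable. Only row 0 is addable without such a partner.\<close>

lemma addable_eq: "{r. addable f r} = insert 0 (Suc ` {r. removable f r})"
proof -
  have "r \<in> {r. addable f r} \<longleftrightarrow> r \<in> insert 0 (Suc ` {r. removable f r})" for r
    by (cases r) (auto simp: addable_def removable_def)
  then show ?thesis by blast
qed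

lemma finite_addable: "finite (cells f) \<Longrightarrow> finite {r. addable f r}"
  by (simp add: addable_eq finite_removable)

lemma finite_cells_remove_box: "finite (cells f) \<Longrightarrow> finite (cells (remove_box r f))"
  by (rule finite_subset[of _ "cells f"]) (auto simp: cells_def remove_box_def split: if_splits)

text \<open>A new square is seen only by the rows strictly above it. This asymmetry is the source of
  the anticommutation.\<close>

lemma row_sign_add_box:
  assumes "finite (cells f)"
  shows "row_sign (add_box s f) r = (if r < s then - row_sign f r else row_sign f r)"
proof -
  have "{c \<in> cells (add_box s f). r < fst c} =
      (if r < s then insert (s, f s) {c \<in> cells f. r < fst c} else {c \<in> cells f. r < fst c})"
    by (auto simp: cells_add_box)
  then show ?thesis using assms by (simp add: row_sign_def)
qed

lemma row_sign_remove_box: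
  assumes "finite (cells f)" "removable f s"
  shows "row_sign (remove_box s f) r = (if r < s then - row_sign f r else row_sign f r)"
  using row_sign_add_box[OF finite_cells_remove_box[OF assms(1)], of s s r] add_remove_box[OF assms(2)]
  by simp

lemma row_sign_square [simp]: "row_sign f r * row_sign f r = 1"
  by (simp add: row_sign_def flip: power_add)

lemma odd_row_sign_add_box:
  assumes "finite (cells f)"
  shows "odd_row_sign (add_box r f) = (- 1) ^ r * odd_row_sign f"
proof -
  have "{c \<in> cells (add_box r f). odd (fst c)} =
      (if odd r then insert (r, f r) {c \<in> cells f. odd (fst c)} else {c \<in> cells f. odd (fst c)})"
    by (auto simp: cells_add_box)
  then show ?thesis using assms by (simp add: odd_row_sign_def)
qed

lemma add_box_shapes:
  assumes "f \<in> shapes n" "addable f r"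
  shows "add_box r f \<in> shapes (Suc n)"
  using assms by (simp add: shapes_def antimono_add_box cells_add_box)

lemma remove_box_shapes:
  assumes "f \<in> shapes (Suc n)" "removable f r"
  shows "remove_box r f \<in> shapes n"
proof -
  have "cells f = insert (r, remove_box r f r) (cells (remove_box r f))"
    using cells_add_box[of r "remove_box r f"] add_remove_box[OF assms(2)] by simp
  moreover have "finite (cells (remove_box r f))"
    using assms(1) by (simp add: shapes_def finite_cells_remove_box)
  ultimately have "card (cells f) = Suc (card (cells (remove_box r f)))"
    by simp
  then show ?thesis
    using assms by (simp add: shapes_def antimono_remove_box finite_cells_remove_box)
qed

section \<open>The relation \<open>D U + U D = 1\<close>\<close>

lemma sum_addable_removable:
  assumes "finite (cells f)"
  shows "(\<Sum>r | addable f r. (- 1) ^ r) + (\<Sum>r | removable f r. (- 1) ^ r) = (1 :: int)"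
proof -
  have "(\<Sum>r | addable f r. (- 1) ^ r) = 1 + (\<Sum>r\<in>Suc ` {r. removable f r}. (- 1 :: int) ^ r)"
    by (simp add: addable_eq finite_removable assms)
  also have "(\<Sum>r\<in>Suc ` {r. removable f r}. (- 1 :: int) ^ r) = - (\<Sum>r | removable f r. (- 1) ^ r)"
    by (simp add: sum.reindex sum_negf)
  finally show ?thesis by simp
qed

text \<open>The two operations interact only when \<open>s\<close> is the row just above
  \<open>r\<close>, and then both orders require \<open>f r + 1 < f s\<close>.\<close>

lemma add_remove_pairs_eq:
  assumes "antimono f" "r \<noteq> s"
  shows "addable f r \<and> removable (add_box r f) s \<longleftrightarrow>
    removable f s \<and> addable (remove_box s f) r"
proof -
  have "f (Suc k) \<le> f k" for k using assms(1) by (simp add: antimono_iff_le_Suc)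
  then show ?thesis using assms(2)
    by (cases r) (auto simp: addable_def removable_def add_box_def remove_box_def split: if_splits)
qed

lemma signed_down_up:
  assumes anti: "antimono f" and fin: "finite (cells f)"
  shows "signed_down (signed_up x) f + signed_up (signed_down x) f = x f"
proof -
  \<comment> \<open>These index the off-diagonal terms. The diagonal ones, \<open>r = s\<close>,
    return to \<open>f\<close> and are split off first.\<close>
  let ?P = "SIGMA r:{r. addable f r}. {s. removable (add_box r f) s} - {r}"
  let ?Q = "SIGMA s:{s. removable f s}. {r. addable (remove_box s f) r} - {s}"
  let ?t = "\<lambda>r s. (- 1) ^ r * row_sign f r * (row_sign (add_box r f) s * x (remove_box s (add_box r f)))"
  let ?u = "\<lambda>s r. row_sign f s * ((- 1) ^ r * row_sign (remove_box s f) r * x (add_box r (remove_box s f)))"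
  have fA: "finite {s. removable (add_box r f) s}" for r
    using fin by (simp add: finite_removable cells_add_box)
  have fR: "finite {r. addable (remove_box s f) r}" for s
    using fin by (simp add: finite_addable finite_cells_remove_box)
  have "signed_down (signed_up x) f =
      (\<Sum>r | addable f r. \<Sum>s | removable (add_box r f) s. ?t r s)"
    by (simp add: signed_down_def signed_up_def sum_distrib_left)
  also have "\<dots> = (\<Sum>r | addable f r. ?t r r + (\<Sum>s\<in>{s. removable (add_box r f) s} - {r}. ?t r s))"
    by (intro sum.cong refl sum.remove fA) (simp add: removable_add_box anti)
  also have "\<dots> = (\<Sum>r | addable f r. (- 1) ^ r * x f + (\<Sum>s\<in>{s. removable (add_box r f) s} - {r}. ?t r s))"
  proof (rule sum.cong[OF refl])
    fix r
    \<comment> \<open>Row \<open>r\<close> does not see its own new square, so both row signs agree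
      and their product is 1.\<close>
    have "?t r r = (row_sign f r * row_sign f r) * ((- 1) ^ r * x f)"
      using fin by (simp add: row_sign_add_box del: row_sign_square)
    then show "?t r r + (\<Sum>s\<in>{s. removable (add_box r f) s} - {r}. ?t r s) =
      (- 1) ^ r * x f + (\<Sum>s\<in>{s. removable (add_box r f) s} - {r}. ?t r s)" by simp
  qed
  also have "\<dots> = (\<Sum>r | addable f r. (- 1) ^ r * x f) + (\<Sum>(r, s)\<in>?P. ?t r s)"
    using fin by (simp add: sum.distrib sum.Sigma fA finite_addable)
  finally have DU: "signed_down (signed_up x) f =
      (\<Sum>r | addable f r. (- 1) ^ r * x f) + (\<Sum>(r, s)\<in>?P. ?t r s)" .
  have "signed_up (signed_down x) f =
      (\<Sum>s | removable f s. \<Sum>r | addable (remove_box s f) r. ?u s r)"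
    by (simp add: signed_down_def signed_up_def sum_distrib_left)
  also have "\<dots> = (\<Sum>s | removable f s. ?u s s + (\<Sum>r\<in>{r. addable (remove_box s f) r} - {s}. ?u s r))"
    by (intro sum.cong refl sum.remove fR) (simp add: addable_remove_box anti)
  also have "\<dots> = (\<Sum>s | removable f s. (- 1) ^ s * x f + (\<Sum>r\<in>{r. addable (remove_box s f) r} - {s}. ?u s r))"
  proof (rule sum.cong[OF refl])
    fix s assume "s \<in> {s. removable f s}"
    then have "?u s s = (row_sign f s * row_sign f s) * ((- 1) ^ s * x f)"
      using fin by (simp add: row_sign_remove_box add_remove_box del: row_sign_square)
    then show "?u s s + (\<Sum>r\<in>{r. addable (remove_box s f) r} - {s}. ?u s r) =
       (- 1) ^ s * x f + (\<Sum>r\<in>{r. addable (remove_box s f) r} - {s}. ?u s r)" by simp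
  qed
  also have "\<dots> = (\<Sum>s | removable f s. (- 1) ^ s * x f) + (\<Sum>(s, r)\<in>?Q. ?u s r)"
    using fin by (simp add: sum.distrib sum.Sigma fR finite_removable)
  finally have UD: "signed_up (signed_down x) f =
      (\<Sum>s | removable f s. (- 1) ^ s * x f) + (\<Sum>(s, r)\<in>?Q. ?u s r)" .
  have "(\<Sum>(s, r)\<in>?Q. ?u s r) = (\<Sum>(r, s)\<in>?P. - ?t r s)"
  proof (rule sum.reindex_bij_witness[of _ prod.swap prod.swap])
    fix p assume "p \<in> ?Q"
    then obtain s r where p: "p = (s, r)" "removable f s" "addable (remove_box s f) r" "r \<noteq> s" by auto
    then show "prod.swap p \<in> ?P" using add_remove_pairs_eq[OF anti, of r s] by auto
    \<comment> \<open>If \<open>r < s\<close>, removing the square first flips the sign of row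
      \<open>r\<close>; if \<open>s < r\<close>, adding first flips the sign of row
      \<open>s\<close>. Exactly one of the two orders is affected.\<close>
    have "?u s r = - ?t r s"
      using p fin by (cases "r < s") (auto simp: row_sign_remove_box row_sign_add_box remove_box_add_box_commute)
    then show "(case prod.swap p of (r, s) \<Rightarrow> - ?t r s) = (case p of (s, r) \<Rightarrow> ?u s r)"
      using p by simp
  next
    fix p assume "p \<in> ?P"
    then obtain r s where "p = (r, s)" "addable f r" "removable (add_box r f) s" "r \<noteq> s" by auto
    then show "prod.swap p \<in> ?Q" using add_remove_pairs_eq[OF anti, of r s] by auto
  qed auto
  also have "\<dots> = - (\<Sum>(r, s)\<in>?P. ?t r s)"
    by (simp add: sum_negf case_prod_unfold)
  finally have "signed_down (signed_up x) f + signed_up (signed_down x) f =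
     ((\<Sum>r | addable f r. (- 1) ^ r) + (\<Sum>r | removable f r. (- 1) ^ r)) * x f"
    using DU UD by (simp add: distrib_right sum_distrib_right)
  then show ?thesis using sum_addable_removable[OF fin] by simp
qed

section \<open>Partitions as shapes\<close>

lemma shapes_0: "shapes 0 = {\<lambda>_. 0}"
proof -
  have "finite (cells f) \<and> card (cells f) = 0 \<longleftrightarrow> cells f = {}" for f by auto
  moreover have "cells f = {} \<longleftrightarrow> f = (\<lambda>_. 0)" for f
    by (auto simp: cells_def fun_eq_iff)
  ultimately show ?thesis by (auto simp: shapes_def antimono_def)
qed

lemma cells_eq_Sigma:
  assumes "\<forall>i\<ge>N. f i = 0"
  shows "cells f = (SIGMA i:{..<N}. {..<f i})"
proof -
  have "i < N" if "j < f i" for i j using assms that by (metis leI not_less0)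
  then show ?thesis by (auto simp: cells_def)
qed

lemma sum_list_eq_card_cells:
  assumes "\<forall>i\<ge>N. f i = 0"
  shows "sum_list (map f [0..<N]) = card (cells f)"
  by (simp add: cells_eq_Sigma[OF assms] card_SigmaI sum_list_distinct_conv_sum_set lessThan_atLeast0)

definition row_length :: "nat list \<Rightarrow> nat \<Rightarrow> nat" where
  "row_length \<mu> i = (if i < length \<mu> then \<mu> ! i else 0)"

lemma map_row_length: "map (row_length \<mu>) [0..<length \<mu>] = \<mu>"
  by (rule nth_equalityI) (simp_all add: row_length_def)

lemma ferrers_eq_cells: "ferrers \<mu> = cells (row_length \<mu>)"
  by (auto simp: ferrers_def cells_def row_length_def split: if_splits)

lemma bij_betw_row_length: "bij_betw row_length (partitions_of n) (shapes n)"
  unfolding bij_betw_def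
proof
  show "inj_on row_length (partitions_of n)"
  proof (rule inj_onI)
    fix \<mu> \<nu> assume *: "\<mu> \<in> partitions_of n" "\<nu> \<in> partitions_of n" "row_length \<mu> = row_length \<nu>"
    \<comment> \<open>Since no part is 0, the padded function determines the length of the
      list.\<close>
    have len: "i < length \<mu> \<longleftrightarrow> 0 < row_length \<mu> i" if "\<mu> \<in> partitions_of n" for \<mu> i
      using that nth_mem[of i \<mu>] by (cases "\<mu> ! i") (auto simp: row_length_def partitions_of_def)
    have "{..<length \<mu>} = {..<length \<nu>}"
      by (simp add: set_eq_iff len[OF *(1)] len[OF *(2)] *(3))
    then have "length \<mu> = length \<nu>" by (simp only: lessThan_eq_iff)
    then show "\<mu> = \<nu>" using map_row_length *(3) by metis
  qed
  show "row_length ` partitions_of n = shapes n"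
  proof (intro set_eqI iffI)
    fix f assume "f \<in> row_length ` partitions_of n"
    then obtain \<mu> where \<mu>: "\<mu> \<in> partitions_of n" "f = row_length \<mu>" by auto
    have "antimono f"
      unfolding antimono_iff_le_Suc
      using \<mu> by (auto simp: partitions_of_def row_length_def sorted_wrt_iff_nth_less)
    moreover have "card (cells f) = n"
      using sum_list_eq_card_cells[of "length \<mu>" f] map_row_length[of \<mu>] \<mu>
      by (simp add: row_length_def partitions_of_def)
    ultimately show "f \<in> shapes n"
      using \<mu> by (simp add: shapes_def finite_ferrers flip: ferrers_eq_cells)
  next
    fix f assume f: "f \<in> shapes n"
    then have anti: "antimono f" and fin: "finite (cells f)" by (auto simp: shapes_def)
    have "\<exists>i. f i = 0"
    proof (rule ccontr)
      assume "\<nexists>i. f i = 0"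
      \<comment> \<open>A function without zeros would have an infinite first column.\<close>
      then have "range (\<lambda>i. (i, 0)) \<subseteq> cells f" by (auto simp: cells_def)
      then have "finite (range (\<lambda>i::nat. (i, 0::nat)))" using fin by (rule finite_subset)
      then show False by (auto dest!: finite_imageD simp: inj_on_def)
    qed
    \<comment> \<open>The least zero is the number of parts: all earlier values are positive, all
      later ones vanish by monotonicity.\<close>
    define N where "N = (LEAST i. f i = 0)"
    have N: "f N = 0" unfolding N_def by (rule LeastI_ex) fact
    have pos: "0 < f i" if "i < N" for i using not_less_Least[OF that[unfolded N_def]] by simp
    have supp: "\<forall>i\<ge>N. f i = 0" using antimonoD[OF anti] N by (metis le_zero_eq)
    have "f = row_length (map f [0..<N])" using supp by (auto simp: row_length_def)
    moreover have "map f [0..<N] \<in> partitions_of n"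
    proof -
      have "0 \<notin> set (map f [0..<N])" using pos by force
      moreover have "sorted_wrt (\<ge>) (map f [0..<N])"
        by (auto simp: sorted_wrt_iff_nth_less intro: antimonoD[OF anti])
      ultimately show ?thesis
        using f sum_list_eq_card_cells[OF supp] by (simp add: partitions_of_def shapes_def)
    qed
    ultimately show "f \<in> row_length ` partitions_of n" by blast
  qed
qed

lemma finite_shapes: "finite (shapes n)"
  using bij_betw_finite[OF bij_betw_row_length] finite_partitions_of by blast

section \<open>Adjointness and the vanishing norm\<close>

text \<open>Both sides sum over the same pairs of shapes differing by one square, once indexed by
  the larger shape and once by the smaller.\<close>

lemma signed_up_adjoint:
  "(\<Sum>f\<in>shapes (Suc n). odd_row_sign f * (y f * signed_up x f)) =
    (\<Sum>f\<in>shapes n. odd_row_sign f * (x f * signed_down y f))"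
proof -
  let ?t = "\<lambda>f r. odd_row_sign f * (y f * (row_sign f r * x (remove_box r f)))"
  let ?u = "\<lambda>f r. odd_row_sign f * (x f * ((- 1) ^ r * row_sign f r * y (add_box r f)))"
  have "(\<Sum>f\<in>shapes (Suc n). odd_row_sign f * (y f * signed_up x f)) =
      (\<Sum>f\<in>shapes (Suc n). \<Sum>r | removable f r. ?t f r)"
    by (simp add: signed_up_def sum_distrib_left)
  also have "\<dots> = (\<Sum>(f, r)\<in>(SIGMA f:shapes (Suc n). {r. removable f r}). ?t f r)"
    by (intro sum.Sigma finite_shapes) (auto simp: shapes_def finite_removable)
  also have "\<dots> = (\<Sum>(f, r)\<in>(SIGMA f:shapes n. {r. addable f r}). ?u f r)"
  proof (rule sum.reindex_bij_witness[of _ "\<lambda>(f, r). (add_box r f, r)" "\<lambda>(f, r). (remove_box r f, r)"])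
    fix p assume "p \<in> (SIGMA f:shapes (Suc n). {r. removable f r})"
    then obtain f r where p: "p = (f, r)" "f \<in> shapes (Suc n)" "removable f r" by auto
    then have f: "antimono f" "finite (cells f)" by (auto simp: shapes_def)
    show "(case case p of (f, r) \<Rightarrow> (remove_box r f, r) of (f, r) \<Rightarrow> (add_box r f, r)) = p"
      using p by (simp add: add_remove_box)
    show "(case p of (f, r) \<Rightarrow> (remove_box r f, r)) \<in> (SIGMA f:shapes n. {r. addable f r})"
      using p f by (simp add: remove_box_shapes addable_remove_box)
    have "odd_row_sign f = (- 1) ^ r * odd_row_sign (remove_box r f)"
      using odd_row_sign_add_box[OF finite_cells_remove_box[OF f(2)], of r r] p
      by (simp add: add_remove_box)
    then show "(case case p of (f, r) \<Rightarrow> (remove_box r f, r) of (f, r) \<Rightarrow> ?u f r) = (case p of (f, r) \<Rightarrow> ?t f r)"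
      using p f by (simp add: row_sign_remove_box add_remove_box)
  next
    fix p assume "p \<in> (SIGMA f:shapes n. {r. addable f r})"
    then obtain f r where p: "p = (f, r)" "f \<in> shapes n" "addable f r" by auto
    then have f: "antimono f" by (auto simp: shapes_def)
    show "(case case p of (f, r) \<Rightarrow> (add_box r f, r) of (f, r) \<Rightarrow> (remove_box r f, r)) = p"
      using p by simp
    show "(case p of (f, r) \<Rightarrow> (add_box r f, r)) \<in> (SIGMA f:shapes (Suc n). {r. removable f r})"
      using p f by (simp add: add_box_shapes removable_add_box)
  qed
  also have "\<dots> = (\<Sum>f\<in>shapes n. \<Sum>r | addable f r. ?u f r)"
    by (intro sum.Sigma[symmetric] finite_shapes) (auto simp: shapes_def finite_addable)
  also have "\<dots> = (\<Sum>f\<in>shapes n. odd_row_sign f * (x f * signed_down y f))"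
    by (simp add: signed_down_def sum_distrib_left)
  finally show ?thesis .
qed

text \<open>Repeated use of \<open>D U = 1 - U D\<close> turns \<open>D U^(n+1)\<close> on the empty
  shape alternately into \<open>U^n\<close> and 0.\<close>

lemma signed_down_imbalance:
  assumes "f \<in> shapes n"
  shows "signed_down (imbalance (Suc n)) f = (if even n then imbalance n f else 0)"
  using assms
proof (induction n arbitrary: f)
  case 0
  then have "f = (\<lambda>_. 0)" by (simp add: shapes_0)
  \<comment> \<open>The empty shape has no removable row, so the term \<open>U D\<close> vanishes
    there.\<close>
  then have "signed_up g f = 0" for g by (simp add: signed_up_def removable_def)
  then show ?case using signed_down_up[of f "imbalance 0"] 0 by (simp add: shapes_def)
next
  case (Suc n)
  have "signed_up (signed_down (imbalance (Suc n))) f =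
      (\<Sum>r | removable f r. row_sign f r * (if even n then imbalance n (remove_box r f) else 0))"
    unfolding signed_up_def
    by (intro sum.cong refl) (use Suc remove_box_shapes in auto)
  also have "\<dots> = (if even n then imbalance (Suc n) f else 0)"
    by (auto simp: signed_up_def)
  finally show ?case
    using signed_down_up[of f "imbalance (Suc n)"] Suc.prems by (auto simp: shapes_def)
qed

text \<open>Moving one \<open>U\<close> across the form as \<open>D\<close> reduces the norm at
  \<open>m + 1\<close> to the norm at \<open>m\<close> for even \<open>m\<close> and to 0 for odd
  \<open>m\<close>. Of two consecutive reductions one has odd \<open>m\<close>.\<close>

lemma sum_imbalance_square:
  assumes "2 \<le> n"
  shows "(\<Sum>f\<in>shapes n. odd_row_sign f * (imbalance n f)\<^sup>2) = 0"
proof -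
  have step: "(\<Sum>f\<in>shapes (Suc m). odd_row_sign f * (imbalance (Suc m) f)\<^sup>2) =
      (if even m then (\<Sum>f\<in>shapes m. odd_row_sign f * (imbalance m f)\<^sup>2) else 0)" for m
  proof -
    have "(\<Sum>f\<in>shapes (Suc m). odd_row_sign f * (imbalance (Suc m) f)\<^sup>2) =
        (\<Sum>f\<in>shapes m. odd_row_sign f * (imbalance m f * signed_down (imbalance (Suc m)) f))"
      using signed_up_adjoint[where n = m and x = "imbalance m" and y = "imbalance (Suc m)"]
      by (simp add: power2_eq_square)
    also have "\<dots> = (\<Sum>f\<in>shapes m. odd_row_sign f * (imbalance m f * (if even m then imbalance m f else 0)))"
      by (intro sum.cong refl) (simp only: signed_down_imbalance)
    finally show ?thesis by (simp add: power2_eq_square)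
  qed
  obtain k where k: "n = Suc (Suc k)" using assms by (metis add_2_eq_Suc le_Suc_ex)
  show ?thesis using step[of k] step[of "Suc k"] by (cases "even k") (simp_all only: k even_Suc if_True if_False, auto)
qed


section \<open>Inversions and reading words\<close>

lemma card_inversions_Cons:
  "card (inversions (x # w)) = length (filter (\<lambda>y. y < x) w) + card (inversions w)"
proof -
  have "inversions (x # w) =
      (\<lambda>j. (0, Suc j)) ` {j. j < length w \<and> w ! j < x} \<union> map_prod Suc Suc ` inversions w"
    (is "_ = ?A \<union> ?B")
  proof (intro set_eqI iffI)
    fix p assume "p \<in> inversions (x # w)"
    then obtain i j where p: "p = (i, Suc j)" "i < Suc j" "j < length w" "(x # w) ! i > w ! j"
      by (cases p; cases "snd p") (auto simp: inversions_def)
    show "p \<in> ?A \<union> ?B"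
    proof (cases i)
      case (Suc k)
      then have "(k, j) \<in> inversions w" using p by (simp add: inversions_def)
      then show ?thesis using p Suc by force
    qed (use p in auto)
  qed (auto simp: inversions_def)
  moreover have "?A \<inter> ?B = {}" by auto
  moreover have "card ?A = length (filter (\<lambda>y. y < x) w)"
    by (simp add: card_image inj_on_def length_filter_conv_card)
  moreover have "card ?B = card (inversions w)"
    by (intro card_image) (auto simp: inj_on_def)
  ultimately show ?thesis by (simp add: card_Un_disjoint finite_inversions)
qed

text \<open>The maximum exceeds all letters after it and none of those before it are larger, so
  exactly the letters of \<open>v\<close> give new inversions.\<close>

lemma card_inversions_insert_max:
  assumes "\<forall>x\<in>set (u @ v). x < m"
  shows "card (inversions (u @ m # v)) = length v + card (inversions (u @ v))"
  using assms
proof (induction u)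
  case Nil
  then show ?case by (simp add: card_inversions_Cons filter_id_conv)
next
  case (Cons x u)
  then show ?case by (simp add: card_inversions_Cons)
qed

lemma concat_update:
  assumes "r < length T"
  shows "concat (T[r := w]) = concat (take r T) @ w @ concat (drop (Suc r) T)"
  using assms by (simp add: upd_conv_take_nth_drop)

lemma concat_split:
  assumes "r < length T"
  shows "concat T = concat (take r T) @ T ! r @ concat (drop (Suc r) T)"
  using concat_update[OF assms, of "T ! r"] by simp

lemma ferrers_map: "ferrers (map f [0..<N]) = {(i, j). i < N \<and> j < f i}"
  by (auto simp: ferrers_def)

text \<open>This identifies the part of the reading word after row \<open>r\<close> with the
  exponent in \<open>row_sign\<close>.\<close>

lemma length_rows_below:
  assumes "\<forall>i\<ge>N. f i = 0" "map length T = map f [0..<N]"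
  shows "length (concat (drop (Suc r) T)) = card {c \<in> cells f. r < fst c}"
proof -
  have "length (concat (drop (Suc r) T)) = sum_list (drop (Suc r) (map f [0..<N]))"
    by (simp add: length_concat drop_map flip: assms(2))
  also have "\<dots> = (\<Sum>i\<in>{Suc r..<N}. f i)"
    by (simp add: drop_map sum_list_distinct_conv_sum_set)
  also have "\<dots> = card (SIGMA i:{Suc r..<N}. {..<f i})"
    by simp
  also have "(SIGMA i:{Suc r..<N}. {..<f i}) = {c \<in> cells f. r < fst c}"
    unfolding cells_eq_Sigma[OF assms(1)] by auto
  finally show ?thesis .
qed

section \<open>Removing the largest entry of a tableau\<close>

text \<open>With a fixed bound \<open>N\<close> on the number of rows, a row that loses its last
  square stays in the tableau as an empty list. The number of rows is then constant throughout the
  induction on size.\<close>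

lemma SYT_map_iff:
  assumes "\<forall>i\<ge>N. f i = 0"
  shows "T \<in> SYT (map f [0..<N]) \<longleftrightarrow>
    map length T = map f [0..<N] \<and> distinct (concat T) \<and> set (concat T) = {1..card (cells f)} \<and>
    (\<forall>i j. i < N \<and> Suc j < f i \<longrightarrow> T ! i ! j < T ! i ! Suc j) \<and>
    (\<forall>i j. Suc i < N \<and> j < f i \<and> j < f (Suc i) \<longrightarrow> T ! i ! j < T ! Suc i ! j)"
proof -
  have "(\<forall>i j. (i, j) \<in> ferrers (map f [0..<N]) \<and> (i, Suc j) \<in> ferrers (map f [0..<N]) \<longrightarrow> T ! i ! j < T ! i ! Suc j) \<longleftrightarrow>
      (\<forall>i j. i < N \<and> Suc j < f i \<longrightarrow> T ! i ! j < T ! i ! Suc j)"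
    by (auto simp: ferrers_map)
  moreover have "(\<forall>i j. (i, j) \<in> ferrers (map f [0..<N]) \<and> (Suc i, j) \<in> ferrers (map f [0..<N]) \<longrightarrow> T ! i ! j < T ! Suc i ! j) \<longleftrightarrow>
      (\<forall>i j. Suc i < N \<and> j < f i \<and> j < f (Suc i) \<longrightarrow> T ! i ! j < T ! Suc i ! j)"
    by (auto simp: ferrers_map)
  ultimately show ?thesis
    unfolding SYT_def mem_Collect_eq sum_list_eq_card_cells[OF assms] by blast
qed

definition append_to_row :: "nat \<Rightarrow> nat \<Rightarrow> nat list list \<Rightarrow> nat list list" where
  "append_to_row m r T = T[r := T ! r @ [m]]"

lemma map_length_eq_iff:
  "map length T = map f [0..<N] \<longleftrightarrow> length T = N \<and> (\<forall>i<N. length (T ! i) = f i)"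
  by (auto simp: list_eq_iff_nth_eq[of "map length T"])

context
  fixes f :: "nat \<Rightarrow> nat" and N n :: nat
  assumes supp: "\<forall>i\<ge>N. f i = 0" and f: "f \<in> shapes (Suc n)"
begin

lemma supp_remove_box: "\<forall>i\<ge>N. remove_box r f i = 0"
  using supp by (simp add: remove_box_def)

lemma removable_less: "removable f r \<Longrightarrow> r < N"
  using supp by (cases "r < N") (simp_all add: removable_def)

lemma SYT_entry_le:
  assumes "T \<in> SYT (map (remove_box r f) [0..<N])" "removable f r" "i < N" "x \<in> set (T ! i)"
  shows "x < Suc n"
proof -
  have "i < length T" using assms(1,3) by (simp add: SYT_map_iff[OF supp_remove_box] map_length_eq_iff)
  then have "x \<in> set (concat T)" using assms(4) by (auto intro: nth_mem)
  moreover have "set (concat T) = {1..n}"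
    using assms(1) remove_box_shapes[OF f assms(2)]
    by (simp add: SYT_map_iff[OF supp_remove_box] shapes_def del: set_concat)
  ultimately have "x \<in> {1..n}" by (simp only:)
  then show ?thesis by simp
qed

text \<open>The new entry exceeds all others and ends its row, and removability of \<open>r\<close>
  leaves no square below it. It is therefore always the larger side of a comparison.\<close>

lemma append_to_row_SYT:
  assumes r: "removable f r" and T: "T \<in> SYT (map (remove_box r f) [0..<N])"
  shows "append_to_row (Suc n) r T \<in> SYT (map f [0..<N])"
proof -
  let ?T = "append_to_row (Suc n) r T"
  have rN: "r < N" using r by (rule removable_less)
  have card: "card (cells f) = Suc n" "card (cells (remove_box r f)) = n"
    using f remove_box_shapes[OF f r] by (auto simp: shapes_def)
  note T' = T[unfolded SYT_map_iff[OF supp_remove_box] map_length_eq_iff card]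
  have len: "length T = N" and lenr: "length (T ! r) = f r - 1" and leni: "\<And>i. i < N \<Longrightarrow> i \<noteq> r \<Longrightarrow> length (T ! i) = f i"
    using T' rN by (auto simp: remove_box_def)
  have fr: "0 < f r" using removable_pos[OF r] .
  have nth: "?T ! i = (if i = r then T ! r @ [Suc n] else T ! i)" if "i < N" for i
    using that len by (simp add: append_to_row_def)
  have small: "T ! i ! j < Suc n" if "i < N" "j < length (T ! i)" for i j
    using SYT_entry_le[OF T r that(1)] that(2) by simp
  have lenT: "map length ?T = map f [0..<N]"
    unfolding map_length_eq_iff using len lenr leni fr nth by (auto simp: append_to_row_def)
  have "concat ?T = concat (take r T) @ (T ! r @ [Suc n]) @ concat (drop (Suc r) T)"
    unfolding append_to_row_def using rN len by (intro concat_update) simp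
  \<comment> \<open>Distinctness and the set of entries depend only on the multiset, so the position
    of the new entry is irrelevant to them.\<close>
  then have "mset (concat ?T) = mset (concat T @ [Suc n])"
    using concat_split[of r T] rN len by simp
  note mset_eq_imp_distinct_iff[OF this] mset_eq_setD[OF this]
  moreover have "distinct (concat T)" "set (concat T) = {1..n}" using T' by blast+
  then have "distinct (concat T @ [Suc n])" "set (concat T @ [Suc n]) = {1..Suc n}"
    by (simp_all add: atLeastAtMostSuc_conv del: set_concat)
  ultimately have "distinct (concat ?T) \<and> set (concat ?T) = {1..card (cells f)}"
    unfolding card by blast
  moreover have "?T ! i ! j < ?T ! i ! Suc j" if "i < N" "Suc j < f i" for i j
  proof (cases "i = r \<and> Suc j = f r - 1")
    case True
    then show ?thesis using that nth lenr small[of r j] rN by (simp add: nth_append)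
  next
    case False
    then have "Suc j < remove_box r f i" using that by (auto simp: remove_box_def)
    then have "T ! i ! j < T ! i ! Suc j" using T' that by blast
    then show ?thesis using False that nth lenr by (auto simp: nth_append)
  qed
  moreover have "?T ! i ! j < ?T ! Suc i ! j" if "Suc i < N" "j < f i" "j < f (Suc i)" for i j
  proof (cases "Suc i = r \<and> j = f r - 1")
    case True
    then show ?thesis using that nth lenr leni small[of i j] by (simp add: nth_append)
  next
    case False
    then have "j < remove_box r f i" "j < remove_box r f (Suc i)"
      using that r by (auto simp: remove_box_def removable_def)
    then have "T ! i ! j < T ! Suc i ! j" using T' that by blast
    then show ?thesis using False that nth lenr r by (auto simp: nth_append removable_def)
  qed
  ultimately show ?thesis unfolding SYT_map_iff[OF supp] using lenT by blast
qed

text \<open>A square to the right of or below the entry \<open>Suc n\<close> would need a still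
  larger entry, so that entry sits in a corner.\<close>

lemma SYT_remove_max:
  assumes T: "T \<in> SYT (map f [0..<N])"
  shows "\<exists>r T'. removable f r \<and> T' \<in> SYT (map (remove_box r f) [0..<N]) \<and>
    T = append_to_row (Suc n) r T'"
proof -
  have card: "card (cells f) = Suc n" using f by (auto simp: shapes_def)
  note T' = T[unfolded SYT_map_iff[OF supp] map_length_eq_iff card]
  have len: "length T = N" and leni: "\<And>i. i < N \<Longrightarrow> length (T ! i) = f i"
    using T' by auto
  have le: "T ! i ! j \<le> Suc n" if "i < N" "j < f i" for i j
  proof -
    have "T ! i ! j \<in> set (concat T)" using that len leni by (auto intro!: bexI[of _ "T ! i"])
    then show ?thesis using T' by (metis atLeastAtMost_iff)
  qed
  have "Suc n \<in> set (concat T)" using T' by auto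
  then obtain r j where r: "r < N" and j: "j < f r" and rj: "T ! r ! j = Suc n"
    using len leni by (auto simp: in_set_conv_nth)
  have "\<not> Suc j < f r"
    using T' r rj le[of r "Suc j"] by (metis not_le)
  then have last: "f r = Suc j" using j by simp
  have rem: "removable f r"
  proof (rule ccontr)
    assume "\<not> removable f r"
    then have *: "j < f (Suc r)" using last by (simp add: removable_def)
    then have "Suc r < N" using supp by (metis leI not_less0)
    then show False using T' * j rj le[of "Suc r" j] by (metis not_le)
  qed
  let ?S = "T[r := butlast (T ! r)]"
  have card': "card (cells (remove_box r f)) = n"
    using remove_box_shapes[OF f rem] by (auto simp: shapes_def)
  have row: "T ! r = butlast (T ! r) @ [Suc n]"
    using leni[OF r] last rj by (metis append_butlast_last_id diff_Suc_1 last_conv_nth length_greater_0_conv zero_less_Suc)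
  have TS: "T = append_to_row (Suc n) r ?S"
    using row r len by (simp add: append_to_row_def)
  have nth: "?S ! i ! k = T ! i ! k" if "i < N" "k < remove_box r f i" for i k
    using that len leni by (cases "i = r") (auto simp: remove_box_def nth_butlast)
  have lenS: "map length ?S = map (remove_box r f) [0..<N]"
    unfolding map_length_eq_iff using len leni by (auto simp: remove_box_def nth_list_update)
  have "concat ?S = concat (take r T) @ butlast (T ! r) @ concat (drop (Suc r) T)"
    using r len by (intro concat_update) simp
  moreover have "concat T = concat (take r T) @ (butlast (T ! r) @ [Suc n]) @ concat (drop (Suc r) T)"
    using concat_split[of r T] r len unfolding row[symmetric] by simp
  ultimately have mset: "mset (concat T) = mset (Suc n # concat ?S)" by simp
  have "distinct (concat T)" "set (concat T) = {1..Suc n}" using T' by blast+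
  then have "distinct (Suc n # concat ?S)" "set (Suc n # concat ?S) = {1..Suc n}"
    using mset_eq_imp_distinct_iff[OF mset] mset_eq_setD[OF mset] by blast+
  then have "distinct (concat ?S)" "set (concat ?S) = {1..Suc n} - {Suc n}"
    by (simp_all del: set_concat) blast
  then have "distinct (concat ?S) \<and> set (concat ?S) = {1..card (cells (remove_box r f))}"
    unfolding card' by (simp add: atLeastAtMostSuc_conv del: set_concat)
  moreover have "?S ! i ! k < ?S ! i ! Suc k" if "i < N" "Suc k < remove_box r f i" for i k
  proof -
    have "Suc k < f i" using that by (auto simp: remove_box_def split: if_splits)
    then show ?thesis using T' that nth[of i k] nth[of i "Suc k"] by auto
  qed
  moreover have "?S ! i ! k < ?S ! Suc i ! k"
    if "Suc i < N" "k < remove_box r f i" "k < remove_box r f (Suc i)" for i k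
  proof -
    have "k < f i" "k < f (Suc i)" using that by (auto simp: remove_box_def split: if_splits)
    then show ?thesis using T' that nth[of i k] nth[of "Suc i" k] by auto
  qed
  ultimately have "?S \<in> SYT (map (remove_box r f) [0..<N])"
    unfolding SYT_map_iff[OF supp_remove_box] using lenS by blast
  then show ?thesis using rem TS by blast
qed

text \<open>The row is recovered as the one containing \<open>Suc n\<close>, an entry too large for
  either smaller tableau.\<close>

lemma append_to_row_inject:
  assumes r: "removable f r" "T \<in> SYT (map (remove_box r f) [0..<N])"
    and s: "removable f s" "S \<in> SYT (map (remove_box s f) [0..<N])"
    and eq: "append_to_row (Suc n) r T = append_to_row (Suc n) s S"
  shows "r = s \<and> T = S"
proof -
  have rN: "r < N" and len: "length T = N" "length S = N"
    using r s removable_less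
    by (auto simp: SYT_map_iff[OF supp_remove_box] map_length_eq_iff)
  have row: "append_to_row (Suc n) r T ! r = T ! r @ [Suc n]"
    using rN len by (simp add: append_to_row_def)
  have "r = s"
  proof (rule ccontr)
    assume "r \<noteq> s"
    then have "S ! r = T ! r @ [Suc n]"
      using eq row by (simp add: append_to_row_def)
    then show False using SYT_entry_le[OF s(2,1) rN, of "Suc n"] by simp
  qed
  moreover have "T = S"
  proof (rule nth_equalityI)
    fix i assume "i < length T"
    then show "T ! i = S ! i"
      using arg_cong[OF eq, of "\<lambda>T. T ! i"] len \<open>r = s\<close>
      by (cases "i = s") (simp_all add: append_to_row_def)
  qed (simp add: len)
  ultimately show ?thesis by simp
qed

lemma tableau_sign_append_to_row:
  assumes r: "removable f r" and T: "T \<in> SYT (map (remove_box r f) [0..<N])"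
  shows "tableau_sign (append_to_row (Suc n) r T) = row_sign f r * tableau_sign T"
proof -
  let ?u = "concat (take r T) @ T ! r" and ?v = "concat (drop (Suc r) T)"
  have len: "map length T = map (remove_box r f) [0..<N]" "length T = N"
    using T by (auto simp: SYT_map_iff[OF supp_remove_box] map_length_eq_iff)
  have rT: "r < length T" using removable_less[OF r] len by simp
  have T1: "concat T = ?u @ ?v" using concat_split[OF rT] by simp
  have T2: "concat (append_to_row (Suc n) r T) = ?u @ Suc n # ?v"
    using concat_update[OF rT] by (simp add: append_to_row_def)
  have "\<forall>x\<in>set (concat T). x < Suc n"
    using SYT_entry_le[OF T r] len by (auto simp: in_set_conv_nth[of _ T])
  then have "card (inversions (?u @ Suc n # ?v)) = length ?v + card (inversions (?u @ ?v))"
    by (intro card_inversions_insert_max) (simp only: T1)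
  moreover have "(- 1) ^ length ?v = row_sign (remove_box r f) r"
    unfolding row_sign_def using length_rows_below[OF supp_remove_box len(1)] by simp
  \<comment> \<open>The exponent counts lower rows only, so it is the same before and after the
    removal in row \<open>r\<close>.\<close>
  moreover have "row_sign (remove_box r f) r = row_sign f r"
    using f r by (simp add: row_sign_remove_box shapes_def)
  ultimately show ?thesis
    unfolding tableau_sign_def word_sign_def T1 T2 by (simp add: power_add)
qed

text \<open>Tableaux correspond to pairs of a corner and a tableau on the rest, which gives the
  recursion defining \<open>signed_up\<close>.\<close>

lemma sign_imbalance_step:
  "sign_imbalance (map f [0..<N]) =
    (\<Sum>r | removable f r. row_sign f r * sign_imbalance (map (remove_box r f) [0..<N]))"
proof -
  let ?P = "SIGMA r:{r. removable f r}. SYT (map (remove_box r f) [0..<N])"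
  have "bij_betw (\<lambda>(r, T). append_to_row (Suc n) r T) ?P (SYT (map f [0..<N]))"
    unfolding bij_betw_def
  proof
    show "inj_on (\<lambda>(r, T). append_to_row (Suc n) r T) ?P"
      using append_to_row_inject by (fastforce simp: inj_on_def)
    show "(\<lambda>(r, T). append_to_row (Suc n) r T) ` ?P = SYT (map f [0..<N])"
      using append_to_row_SYT SYT_remove_max by (auto simp: image_iff) blast
  qed
  then have "sign_imbalance (map f [0..<N]) =
      (\<Sum>p\<in>?P. tableau_sign (case p of (r, T) \<Rightarrow> append_to_row (Suc n) r T))"
    unfolding sign_imbalance_def by (rule sum.reindex_bij_betw[symmetric])
  also have "\<dots> = (\<Sum>(r, T)\<in>?P. row_sign f r * tableau_sign T)"
    by (intro sum.cong refl) (auto simp: tableau_sign_append_to_row)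
  also have "\<dots> = (\<Sum>r | removable f r. \<Sum>T\<in>SYT (map (remove_box r f) [0..<N]). row_sign f r * tableau_sign T)"
    using f by (intro sum.Sigma[symmetric]) (auto simp: shapes_def finite_removable finite_SYT)
  finally show ?thesis by (simp add: sign_imbalance_def sum_distrib_left)
qed

end

lemma sign_imbalance_eq_imbalance:
  assumes "f \<in> shapes n" "\<forall>i\<ge>N. f i = 0"
  shows "sign_imbalance (map f [0..<N]) = imbalance n f"
  using assms
proof (induction n arbitrary: f)
  case 0
  \<comment> \<open>The only tableau of the empty shape consists of \<open>N\<close> empty rows. Its
    word is empty and has sign 1, matching \<open>imbalance 0\<close>.\<close>
  have rows: "map length T = map (\<lambda>_. 0) [0..<N] \<longleftrightarrow> T = replicate N []" for T :: "nat list list"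
    unfolding map_length_eq_iff by (auto simp: list_eq_iff_nth_eq[of T])
  have "cells (\<lambda>_. 0) = {}" by (simp add: cells_def)
  then have "T \<in> SYT (map (\<lambda>_. 0) [0..<N]) \<longleftrightarrow> T = replicate N []" for T
    using SYT_map_iff[of N "\<lambda>_. 0" T] unfolding rows by auto
  then have "SYT (map (\<lambda>_. 0) [0..<N]) = {replicate N []}" by blast
  then show ?case using 0
    by (simp add: shapes_0 sign_imbalance_def tableau_sign_def word_sign_def inversions_def)
next
  case (Suc n)
  have "sign_imbalance (map (remove_box r f) [0..<N]) = imbalance n (remove_box r f)"
    if "removable f r" for r
    using Suc.prems that
    by (intro Suc.IH remove_box_shapes supp_remove_box)
  then show ?case
    by (simp add: sign_imbalance_step[OF Suc.prems(2,1)] signed_up_def)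
qed

section \<open>The domino number as a count of squares in odd rows\<close>

text \<open>Each vertical domino covers exactly one square in an odd row (rows being counted from 0), and
  every such square can be paired with the square above it.\<close>

lemma vdomino_number_eq:
  assumes "antimono (row_length \<mu>)"
  shows "vdomino_number \<mu> = card {c \<in> cells (row_length \<mu>). odd (fst c)}"
  unfolding vdomino_number_def
proof (rule Max_eqI)
  let ?O = "{c \<in> cells (row_length \<mu>). odd (fst c)}"
  have finO: "finite ?O" using finite_ferrers[of \<mu>] by (simp add: ferrers_eq_cells)
  show "finite (card ` vdomino_packings \<mu>)"
    by (simp add: vdomino_packings_finite_nonempty)
  show "k \<le> card ?O" if "k \<in> card ` vdomino_packings \<mu>" for k
  proof -
    obtain D where k: "k = card D" and D: "D \<subseteq> range vertical_domino" "disjoint D" "\<Union>D \<subseteq> ferrers \<mu>"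
      using \<open>k \<in> _\<close> by (auto simp: vdomino_packings_def)
    have "\<exists>c. c \<in> d \<and> odd (fst c)" if "d \<in> D" for d
    proof -
      obtain i j where "d = {(i, j), (Suc i, j)}"
        using \<open>d \<in> D\<close> D(1) by (auto simp: vertical_domino_def)
      then show ?thesis by (cases "odd i") auto
    qed
    then obtain g where g: "\<And>d. d \<in> D \<Longrightarrow> g d \<in> d \<and> odd (fst (g d))" by metis
    \<comment> \<open>Disjoint dominoes cannot share their chosen odd-row squares.\<close>
    have "inj_on g D"
    proof (rule inj_onI, rule ccontr)
      fix d e assume "d \<in> D" "e \<in> D" "g d = g e" "d \<noteq> e"
      then show False using g[of d] g[of e] disjointD[OF D(2), of d e] by auto
    qed
    moreover have "g ` D \<subseteq> ?O" using g D(3) unfolding ferrers_eq_cells by blast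
    ultimately show ?thesis using k finO by (metis card_inj_on_le)
  qed
  have odd_cell: "\<exists>i j. c = (Suc i, j) \<and> even i \<and> j < row_length \<mu> (Suc i)" if "c \<in> ?O" for c
  proof -
    obtain i j where c: "c = (i, j)" by (cases c)
    then have "odd i" "j < row_length \<mu> i" using that by (auto simp: cells_def)
    then show ?thesis using c by (cases i) auto
  qed
  \<comment> \<open>On odd rows \<open>i - 1\<close> is a genuine subtraction, so the domino
    consists of the square and the one above it.\<close>
  let ?h = "\<lambda>(i, j). vertical_domino (i - 1, j)"
  have sub: "?h c \<subseteq> ferrers \<mu>" if cO: "c \<in> ?O" for c
  proof -
    obtain i j where c: "c = (Suc i, j)" "j < row_length \<mu> (Suc i)"
      using odd_cell[OF cO] by blast
    moreover have "row_length \<mu> (Suc i) \<le> row_length \<mu> i"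
      using assms by (simp add: antimono_iff_le_Suc)
    ultimately show ?thesis by (auto simp: ferrers_eq_cells cells_def vertical_domino_def)
  qed
  have disj: "c = d" if cO: "c \<in> ?O" and dO: "d \<in> ?O" and meet: "?h c \<inter> ?h d \<noteq> {}" for c d
  proof -
    obtain i j k l where "c = (Suc i, j)" "d = (Suc k, l)" "even i" "even k"
      using odd_cell[OF cO] odd_cell[OF dO] by blast
    \<comment> \<open>Both dominoes start in even rows, so they cannot overlap with a shift by one
      row.\<close>
    then show ?thesis using meet by (auto simp: vertical_domino_def)
  qed
  have "disjoint (?h ` ?O)"
  proof (rule disjointI, rule ccontr)
    fix a b assume "a \<in> ?h ` ?O" "b \<in> ?h ` ?O" "a \<noteq> b" and meet: "a \<inter> b \<noteq> {}"
    then obtain c d where "c \<in> ?O" "a = ?h c" "d \<in> ?O" "b = ?h d" by (elim imageE)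
    then show False using disj[of c d] meet \<open>a \<noteq> b\<close> by blast
  qed
  moreover have "?h ` ?O \<subseteq> range vertical_domino" by (auto simp: case_prod_unfold)
  moreover have "\<Union> (?h ` ?O) \<subseteq> ferrers \<mu>" by (rule UN_least) (rule sub)
  ultimately have packing: "?h ` ?O \<in> vdomino_packings \<mu>" by (simp add: vdomino_packings_def)
  \<comment> \<open>Equal dominoes meet because they are nonempty, so \<open>disj\<close> also
    yields injectivity.\<close>
  have "inj_on ?h ?O"
    by (rule inj_onI, rule disj) (auto simp: vertical_domino_def)
  then have "card ?O = card (?h ` ?O)" by (rule card_image[symmetric])
  then show "card ?O \<in> card ` vdomino_packings \<mu>" using packing by (rule image_eqI)
qed

section \<open>Transfer from partitions to shapes\<close>

theorem theorem3p6:
  fixes n :: nat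
  assumes "n \<ge> 2"
  shows "(\<Sum>\<mu>\<in>partitions_of n. (- 1) ^ vdomino_number \<mu> * (sign_imbalance \<mu>)\<^sup>2) = 0"
proof -
  have "(\<Sum>\<mu>\<in>partitions_of n. (- 1) ^ vdomino_number \<mu> * (sign_imbalance \<mu>)\<^sup>2) =
      (\<Sum>\<mu>\<in>partitions_of n. odd_row_sign (row_length \<mu>) * (imbalance n (row_length \<mu>))\<^sup>2)"
  proof (rule sum.cong[OF refl])
    fix \<mu> assume "\<mu> \<in> partitions_of n"
    then have \<mu>: "row_length \<mu> \<in> shapes n" using bij_betw_row_length by (auto simp: bij_betw_def)
    have "sign_imbalance \<mu> = imbalance n (row_length \<mu>)"
      using sign_imbalance_eq_imbalance[OF \<mu>, of "length \<mu>"] map_row_length[of \<mu>]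
      by (simp add: row_length_def)
    then show "(- 1) ^ vdomino_number \<mu> * (sign_imbalance \<mu>)\<^sup>2 =
        odd_row_sign (row_length \<mu>) * (imbalance n (row_length \<mu>))\<^sup>2"
      using \<mu> by (simp add: shapes_def vdomino_number_eq odd_row_sign_def)
  qed
  also have "\<dots> = (\<Sum>f\<in>shapes n. odd_row_sign f * (imbalance n f)\<^sup>2)"
    by (rule sum.reindex_bij_betw[OF bij_betw_row_length])
  also have "\<dots> = 0" using assms by (rule sum_imbalance_square)
  finally show ?thesis .
qed

end
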